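(* If $X$ is a proper metric space, then $\nu' X$ is homeomorphic to the Higson corona $\nu(X)$ of $X$.
   Context: A metric space is proper if its closed bounded subsets are compact. The Higson corona $\nu(X)$ of a proper metric space $X$ is the boundary $hX\setminus X$ of the Higson compactification $hX$, i.e. the compactification of $X$ determined by the algebra of bounded continuous functions $\varphi:X\to\mathbb C$ such that for every $R>0$ and $\varepsilon>0$ there is a bounded (equivalently, relatively compact) set $K\subseteq X$ with $|\varphi(x)-\varphi(y)|<\varepsilon$ whenever $d(x,y)\le R$ and $x,y\notin K$. All metrics take finite values. For a metric space $X$, an entourage is a set $E\subseteq X^2$ with $\sup_{(x,y)\in E}d(x,y)<\infty$; a subset $B\subseteq X$ is bounded if $B^2$ is an entourage; $E[A]$ denotes the set of points of $X$ that are $E$-related to some point of $A$. Subsets $A,B\subseteq X$ are coarsely disjoint, $A\not\curlywedge B$, if $E[A]\cap E[B]$ is bounded for every entourage $E$; otherwise they are close, $A\curlywedge B$. A coarse ultrafilter on $X$ is a system $\mathcal F$ of subsets of $X$ such that (1) $A,B\in\mathcal F$ implies $A\curlywedge B$; (2) if $A,B\subseteq X$ and $A\cup B\in\mathcal F$ then $A\in\mathcal F$ or $B\in\mathcal F$; (3) $X\in\mathcal F$. Two coarse ultrafilters $\mathcal F,\mathcal G$ are asymptotically alike, $\mathcal F\lambda\mathcal G$, if $A\curlywedge B$ for all $A\in\mathcal F$, $B\in\mathcal G$; this is an equivalence relation. The corona $\nu' X$ is the set of coarse ultrafilters on $X$ modulo $\lambda$. For $A\subseteq X$ let $\mathrm{cl}(A)\subseteq\nu'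 X$ be the set of classes having a representative $\mathcal F$ with $A\in\mathcal F$. For $\pi_1,\pi_2\subseteq\nu' X$ put $\pi_1\not\curlywedge\pi_2$ if there are $A,B\subseteq X$ with $A\not\curlywedge B$, $\pi_1\subseteq\mathrm{cl}(A)$, $\pi_2\subseteq\mathrm{cl}(B)$, and $\pi_1\curlywedge\pi_2$ otherwise; this is a separated proximity relation and $\nu' X$ carries the induced topology, in which the closure of $\pi$ is $\{x:\{x\}\curlywedge\pi\}$. *)

theory Defs
  imports "HOL-Analysis.Analysis"
begin

context Metric_space
begin

definition proper_metric :: bool where
  "proper_metric \<longleftrightarrow> (\<forall>S. closedin mtopology S \<and> mbounded S \<longrightarrow> compactin mtopology S)"


section \<open>The corona of coarse ultrafilters\<close>

definition entourage :: "('a \<times> 'a) set \<Rightarrow> bool" where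
  "entourage E \<longleftrightarrow> E \<subseteq> M \<times> M \<and> bdd_above ((\<lambda>(x, y). d x y) ` E)"

lemma mbounded_iff_entourage: "mbounded B \<longleftrightarrow> entourage (B \<times> B)"
  unfolding entourage_def mbounded_alt bdd_above_def by fastforce

text \<open>The set \<open>E\<inverse> `` A\<close> consists of the points \<open>x\<close> with \<open>(x, a) \<in> E\<close> for some \<open>a \<in> A\<close>.\<close>

definition coarsely_disjoint :: "'a set \<Rightarrow> 'a set \<Rightarrow> bool" where
  "coarsely_disjoint A B \<longleftrightarrow> (\<forall>E. entourage E \<longrightarrow> mbounded (E\<inverse> `` A \<inter> E\<inverse> `` B))"

abbreviation close :: "'a set \<Rightarrow> 'a set \<Rightarrow> bool" where
  "close A B \<equiv> \<not> coarsely_disjoint A B"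

definition coarse_ultrafilter :: "'a set set \<Rightarrow> bool" where
  "coarse_ultrafilter F \<longleftrightarrow>
     F \<subseteq> Pow M \<and>
     (\<forall>A\<in>F. \<forall>B\<in>F. close A B) \<and>
     (\<forall>A B. A \<subseteq> M \<and> B \<subseteq> M \<and> A \<union> B \<in> F \<longrightarrow> A \<in> F \<or> B \<in> F) \<and>
     M \<in> F"

definition asymptotically_alike :: "('a set set \<times> 'a set set) set" where
  "asymptotically_alike =
     {(F, G). coarse_ultrafilter F \<and> coarse_ultrafilter G \<and> (\<forall>A\<in>F. \<forall>B\<in>G. close A B)}"

definition corona :: "'a set set set set" where
  "corona = Collect coarse_ultrafilter // asymptotically_alike"

definition corona_cl :: "'a set \<Rightarrow> 'a set set set set" where
  "corona_cl A = {c \<in> corona. \<exists>F\<in>c. A \<in> F}"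

definition corona_far :: "'a set set set set \<Rightarrow> 'a set set set set \<Rightarrow> bool" where
  "corona_far P Q \<longleftrightarrow>
     (\<exists>A B. A \<subseteq> M \<and> B \<subseteq> M \<and> coarsely_disjoint A B \<and> P \<subseteq> corona_cl A \<and> Q \<subseteq> corona_cl B)"

abbreviation corona_close :: "'a set set set set \<Rightarrow> 'a set set set set \<Rightarrow> bool" where
  "corona_close P Q \<equiv> \<not> corona_far P Q"

text \<open>
  The topology induced by the proximity: a set is closed iff it contains every point that is
  close to it. That this is a topology, and that its closure operator is the one given by the
  proximity, is proved in \<open>istopology_corona\<close> and \<open>closure_of_corona_topology\<close> below.
\<close>

definition corona_open :: "'a set set set set \<Rightarrow> bool" where
  "corona_open U \<longleftrightarrow> U \<subseteq> corona \<and> {c \<in> corona. corona_close {c} (corona - U)} = corona - U"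

definition corona_topology :: "'a set set set topology" where
  "corona_topology = topology corona_open"


section \<open>The Higson corona\<close>

text \<open>Complex functions on \<open>M\<close> are represented by elements of \<^term>\<open>extensional M\<close>.\<close>

definition higson_functions :: "('a \<Rightarrow> complex) set" where
  "higson_functions =
     {\<phi> \<in> extensional M. continuous_map mtopology euclidean \<phi> \<and> bounded (\<phi> ` M) \<and>
        (\<forall>R>0. \<forall>\<epsilon>>0. \<exists>K. mbounded K \<and>
           (\<forall>x\<in>M - K. \<forall>y\<in>M - K. d x y \<le> R \<longrightarrow> norm (\<phi> x - \<phi> y) < \<epsilon>))}"

definition higson_eval :: "'a \<Rightarrow> (('a \<Rightarrow> complex) \<Rightarrow> complex)" where
  "higson_eval x = (\<lambda>\<phi>\<in>higson_functions. \<phi> x)"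

text \<open>
  The compactification determined by an algebra of bounded continuous functions is the closure
  of the image of the space under the evaluation map into the product of copies of the complex
  plane indexed by the algebra. The space is identified with its image.
\<close>

definition higson_compactification :: "(('a \<Rightarrow> complex) \<Rightarrow> complex) topology" where
  "higson_compactification =
     (let P = product_topology (\<lambda>_. euclidean) higson_functions
      in subtopology P (P closure_of (higson_eval ` M)))"

definition higson_corona :: "(('a \<Rightarrow> complex) \<Rightarrow> complex) topology" where
  "higson_corona =
     subtopology higson_compactification (topspace higson_compactification - higson_eval ` M)"


section \<open>The corona topology is a topology\<close>

lemma coarsely_disjoint_alt:
  assumes "A \<subseteq> M" "B \<subseteq> M"
  shows "coarsely_disjoint A B \<longleftrightarrow>
    (\<forall>r. mbounded {x\<in>M. (\<exists>a\<in>A. d x a \<le> r) \<and> (\<exists>b\<in>B. d x b \<le> r)})"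
proof
  assume L: "coarsely_disjoint A B"
  show "\<forall>r. mbounded {x\<in>M. (\<exists>a\<in>A. d x a \<le> r) \<and> (\<exists>b\<in>B. d x b \<le> r)}"
  proof
    fix r
    let ?E = "{(x,y). x \<in> M \<and> y \<in> M \<and> d x y \<le> r}"
    have "entourage ?E"
      unfolding entourage_def by (auto simp: bdd_above_def)
    then have "mbounded (?E\<inverse> `` A \<inter> ?E\<inverse> `` B)"
      using L by (auto simp: coarsely_disjoint_def)
    then show "mbounded {x\<in>M. (\<exists>a\<in>A. d x a \<le> r) \<and> (\<exists>b\<in>B. d x b \<le> r)}"
      by (rule mbounded_subset) (use assms in auto)
  qed
next
  assume R: "\<forall>r. mbounded {x\<in>M. (\<exists>a\<in>A. d x a \<le> r) \<and> (\<exists>b\<in>B. d x b \<le> r)}"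
  show "coarsely_disjoint A B"
    unfolding coarsely_disjoint_def
  proof (intro allI impI)
    fix E assume E: "entourage E"
    then obtain r where r: "\<And>x y. (x,y) \<in> E \<Longrightarrow> d x y \<le> r"
      by (fastforce simp: entourage_def bdd_above_def)
    show "mbounded (E\<inverse> `` A \<inter> E\<inverse> `` B)"
      by (rule mbounded_subset[OF R[rule_format, of r]])
        (use r E in \<open>fastforce simp: entourage_def\<close>)
  qed
qed

lemma coarsely_disjoint_commute: "coarsely_disjoint A B \<longleftrightarrow> coarsely_disjoint B A"
  by (simp add: coarsely_disjoint_def Int_commute)

lemma coarsely_disjoint_mono:
  "coarsely_disjoint A B \<Longrightarrow> A' \<subseteq> A \<Longrightarrow> B' \<subseteq> B \<Longrightarrow> coarsely_disjoint A' B'"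
  unfolding coarsely_disjoint_def by (meson Image_mono Int_mono mbounded_subset order_refl)

lemma coarsely_disjoint_Un:
  "coarsely_disjoint A B \<Longrightarrow> coarsely_disjoint A C \<Longrightarrow> coarsely_disjoint A (B \<union> C)"
  by (simp add: coarsely_disjoint_def Image_Un Int_Un_distrib mbounded_Un)

lemma coarsely_disjoint_separate:
  assumes "A \<subseteq> M" "B \<subseteq> M" "coarsely_disjoint A B"
  obtains C D where "C \<subseteq> M" "D \<subseteq> M" "C \<union> D = M" "coarsely_disjoint C A" "coarsely_disjoint D B"
proof -
  define D where "D = {x\<in>M. \<exists>a\<in>A. \<forall>b\<in>B. d x a < d x b}"
  have "D \<subseteq> M" "M - D \<subseteq> M"
    by (auto simp: D_def)
  have AB: "\<And>r. mbounded {x\<in>M. (\<exists>a\<in>A. d x a \<le> r) \<and> (\<exists>b\<in>B. d x b \<le> r)}"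
    using assms coarsely_disjoint_alt by blast
  have tri: "d x a \<le> 2*r" "d y a \<le> 3*r" if "d y x \<le> r" "d y a \<le> r" "x \<in> M" "y \<in> M" "a \<in> M" for x y a r
    using triangle[of x y a] commute[of x y] nonneg[of y a] that by linarith+
  have "coarsely_disjoint D B"
    unfolding coarsely_disjoint_alt[OF \<open>D \<subseteq> M\<close> assms(2)]
  proof
    fix r
    show "mbounded {x \<in> M. (\<exists>a\<in>D. d x a \<le> r) \<and> (\<exists>b\<in>B. d x b \<le> r)}"
    proof (rule mbounded_subset[OF AB[of "3*r"]], clarsimp, intro conjI)
      fix y x b assume *: "y \<in> M" "x \<in> D" "d y x \<le> r" "b \<in> B" "d y b \<le> r"
      then obtain a where a: "a \<in> A" "d x a < d x b" "x \<in> M" "a \<in> M" "b \<in> M"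
        using assms by (auto simp: D_def)
      have "d x b \<le> 2*r" using tri * a by blast
      then have "d y a \<le> 3*r" using triangle[of y x a] * a by linarith
      then show "\<exists>a\<in>A. d y a \<le> 3 * r" using a by blast
      show "\<exists>b\<in>B. d y b \<le> 3 * r" using tri * a by blast
    qed
  qed
  moreover have "coarsely_disjoint (M - D) A"
    unfolding coarsely_disjoint_alt[OF \<open>M - D \<subseteq> M\<close> assms(1)]
  proof
    fix r
    show "mbounded {x \<in> M. (\<exists>a\<in>M - D. d x a \<le> r) \<and> (\<exists>b\<in>A. d x b \<le> r)}"
    proof (rule mbounded_subset[OF AB[of "3*r"]], clarsimp, intro conjI)
      fix y x a assume *: "y \<in> M" "x \<in> M" "x \<notin> D" "d y x \<le> r" "a \<in> A" "d y a \<le> r"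
      then obtain b where b: "b \<in> B" "d x b \<le> d x a" "a \<in> M" "b \<in> M"
        using assms by (force simp: D_def)
      have "d x a \<le> 2*r" using tri * b by blast
      then have "d y b \<le> 3*r" using triangle[of y x b] * b by linarith
      then show "\<exists>b\<in>B. d y b \<le> 3 * r" using b by blast
      show "\<exists>a\<in>A. d y a \<le> 3 * r" using tri * b by blast
    qed
  qed
  ultimately show thesis
    using that[of "M - D" D] \<open>D \<subseteq> M\<close> by blast
qed

lemma coarse_ultrafilter_not_disjoint:
  "coarse_ultrafilter F \<Longrightarrow> A \<in> F \<Longrightarrow> B \<in> F \<Longrightarrow> \<not> coarsely_disjoint A B"
  by (auto simp: coarse_ultrafilter_def)

lemma coarse_ultrafilter_upward:
  assumes "coarse_ultrafilter F"
  shows "coarse_ultrafilter {B. B \<subseteq> M \<and> (\<exists>A\<in>F. A \<subseteq> B)}" (is "coarse_ultrafilter ?F")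
  unfolding coarse_ultrafilter_def
proof (intro conjI ballI allI impI)
  fix A B assume "A \<in> ?F" "B \<in> ?F"
  then obtain A' B' where "A' \<in> F" "B' \<in> F" "A' \<subseteq> A" "B' \<subseteq> B"
    by blast
  then show "close A B"
    using coarsely_disjoint_mono[of A B A' B'] coarse_ultrafilter_not_disjoint[OF assms] by metis
next
  fix A B assume *: "A \<subseteq> M \<and> B \<subseteq> M \<and> A \<union> B \<in> ?F"
  then obtain C where C: "C \<in> F" "C \<subseteq> A \<union> B" by blast
  then have "(C \<inter> A) \<union> (C \<inter> B) \<in> F"
    by (metis Int_Un_distrib inf.absorb_iff1)
  then have "C \<inter> A \<in> F \<or> C \<inter> B \<in> F"
    using assms * unfolding coarse_ultrafilter_def by (meson inf.coboundedI2)
  then show "A \<in> ?F \<or> B \<in> ?F"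
    using * by blast
next
  show "?F \<subseteq> Pow M"
    by blast
  show "M \<in> ?F"
    using assms unfolding coarse_ultrafilter_def by blast
qed

lemma corona_cl_mono:
  assumes "A \<subseteq> B" "B \<subseteq> M"
  shows "corona_cl A \<subseteq> corona_cl B"
proof
  fix c assume "c \<in> corona_cl A"
  then obtain F H where c: "c \<in> corona" and F: "F \<in> c" "A \<in> F"
      and H: "c = asymptotically_alike `` {H}"
    unfolding corona_cl_def corona_def quotient_def by blast
  define G where "G = {B. B \<subseteq> M \<and> (\<exists>A\<in>F. A \<subseteq> B)}"
  have "coarse_ultrafilter F" "coarse_ultrafilter H" "\<forall>A\<in>H. \<forall>B\<in>F. close A B"
    using F H by (auto simp: asymptotically_alike_def)
  moreover have "close S T" if ST: "S \<in> H" "T \<in> G" for S T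
  proof -
    obtain T' where "T' \<in> F" "T' \<subseteq> T"
      using ST by (auto simp: G_def)
    then show ?thesis
      using \<open>\<forall>A\<in>H. \<forall>B\<in>F. close A B\<close> \<open>S \<in> H\<close> coarsely_disjoint_mono[of S T S T'] by blast
  qed
  ultimately have "G \<in> c"
    using coarse_ultrafilter_upward[of F] by (simp add: H asymptotically_alike_def G_def)
  moreover have "B \<in> G"
    using F assms by (auto simp: G_def)
  ultimately show "c \<in> corona_cl B"
    using c by (auto simp: corona_cl_def)
qed

lemma corona_far_mono: "corona_far P Q \<Longrightarrow> P' \<subseteq> P \<Longrightarrow> Q' \<subseteq> Q \<Longrightarrow> corona_far P' Q'"
  unfolding corona_far_def by (meson subset_trans)

lemma corona_far_point_Un:
  assumes "corona_far {c} P" "corona_far {c} Q"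
  shows "corona_far {c} (P \<union> Q)"
proof -
  obtain A B where 1: "A \<subseteq> M" "B \<subseteq> M" "coarsely_disjoint A B" "c \<in> corona_cl A" "P \<subseteq> corona_cl B"
    using assms(1) by (auto simp: corona_far_def)
  obtain A' B' where 2: "A' \<subseteq> M" "B' \<subseteq> M" "coarsely_disjoint A' B'" "c \<in> corona_cl A'" "Q \<subseteq> corona_cl B'"
    using assms(2) by (auto simp: corona_far_def)
  obtain H F F' where c: "c \<in> corona" "coarse_ultrafilter H" "c = asymptotically_alike `` {H}"
     and F: "F \<in> c" "A \<in> F" and F': "F' \<in> c" "A' \<in> F'"
    using 1 2 unfolding corona_cl_def corona_def quotient_def by blast
  have "H \<in> c"
    using c by (auto simp: asymptotically_alike_def coarse_ultrafilter_def)
  have notH: "C \<notin> H" if "coarsely_disjoint C A \<or> coarsely_disjoint C A'" for C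
    using that F F' c by (auto simp: asymptotically_alike_def)
  have split: "S \<in> H \<or> T \<in> H" if "S \<subseteq> M" "T \<subseteq> M" "S \<union> T \<in> H" for S T
    using c that unfolding coarse_ultrafilter_def by blast
  have "M \<in> H"
    using c by (auto simp: coarse_ultrafilter_def)
  obtain C D where CD: "C \<subseteq> M" "D \<subseteq> M" "C \<union> D = M" "coarsely_disjoint C A" "coarsely_disjoint D B"
    using coarsely_disjoint_separate 1 by metis
  obtain C' D' where CD': "C' \<subseteq> M" "D' \<subseteq> M" "C' \<union> D' = M" "coarsely_disjoint C' A'" "coarsely_disjoint D' B'"
    using coarsely_disjoint_separate 2 by metis
  have "D \<in> H"
    using split[of C D] CD notH \<open>M \<in> H\<close> by auto
  moreover have "D = (D \<inter> D') \<union> (D - D')"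
    by blast
  moreover have "D - D' \<notin> H"
  proof (rule notH)
    have "D - D' \<subseteq> C'" using CD CD' by blast
    then show "coarsely_disjoint (D - D') A \<or> coarsely_disjoint (D - D') A'"
      using CD'(4) coarsely_disjoint_mono by blast
  qed
  ultimately have "D \<inter> D' \<in> H"
    using split[of "D \<inter> D'" "D - D'"] CD by auto
  then have "{c} \<subseteq> corona_cl (D \<inter> D')"
    using c \<open>H \<in> c\<close> by (auto simp: corona_cl_def)
  moreover have "coarsely_disjoint (D \<inter> D') (B \<union> B')"
    using coarsely_disjoint_mono[OF CD(5)] coarsely_disjoint_mono[OF CD'(5)]
    by (intro coarsely_disjoint_Un) auto
  moreover have "P \<union> Q \<subseteq> corona_cl (B \<union> B')"
    using 1 2 corona_cl_mono[of B "B \<union> B'"] corona_cl_mono[of B' "B \<union> B'"] by blast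
  ultimately show ?thesis
    unfolding corona_far_def using 1 2 CD by (meson Un_least inf.coboundedI1)
qed

lemma corona_far_disjoint:
  assumes "corona_far {c} P"
  shows "c \<notin> P"
proof
  assume "c \<in> P"
  then obtain A B where AB: "A \<subseteq> M" "B \<subseteq> M" "coarsely_disjoint A B" "c \<in> corona_cl A" "c \<in> corona_cl B"
    using assms by (auto simp: corona_far_def)
  then obtain H F G where H: "coarse_ultrafilter H" "c = asymptotically_alike `` {H}"
     and F: "F \<in> c" "A \<in> F" and G: "G \<in> c" "B \<in> G"
    unfolding corona_cl_def corona_def quotient_def by blast
  obtain C D where CD: "C \<subseteq> M" "D \<subseteq> M" "C \<union> D = M" "coarsely_disjoint C A" "coarsely_disjoint D B"
    using coarsely_disjoint_separate AB by metis
  have "C \<in> H \<or> D \<in> H"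
    using H CD unfolding coarse_ultrafilter_def by metis
  then show False
    using F G H CD by (auto simp: asymptotically_alike_def)
qed

lemma corona_open_alt:
  "corona_open U \<longleftrightarrow> U \<subseteq> corona \<and> (\<forall>c\<in>U. corona_far {c} (corona - U))"
proof -
  have "c \<notin> corona - U" if "corona_far {c} (corona - U)" for c
    using that by (rule corona_far_disjoint)
  then show ?thesis
    unfolding corona_open_def by blast
qed

lemma istopology_corona: "istopology corona_open"
  unfolding istopology_def
proof (intro conjI allI impI)
  fix S T assume S: "corona_open S" and T: "corona_open T"
  have "corona - (S \<inter> T) = (corona - S) \<union> (corona - T)" by blast
  then show "corona_open (S \<inter> T)"
    using S T corona_far_point_Un unfolding corona_open_alt by auto
next
  fix \<K> assume K: "\<forall>K\<in>\<K>. corona_open K"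
  show "corona_open (\<Union>\<K>)"
    unfolding corona_open_alt
  proof (intro conjI ballI)
    show "\<Union>\<K> \<subseteq> corona" using K by (auto simp: corona_open_alt)
    fix c assume "c \<in> \<Union>\<K>"
    then obtain U where "U \<in> \<K>" "c \<in> U" by blast
    then show "corona_far {c} (corona - \<Union>\<K>)"
      using K corona_far_mono[of "{c}" "corona - U" "{c}" "corona - \<Union>\<K>"]
      unfolding corona_open_alt by blast
  qed
qed

lemma openin_corona_topology: "openin corona_topology U \<longleftrightarrow> corona_open U"
  by (simp add: corona_topology_def istopology_corona topology_inverse')

lemma closure_of_corona_topology:
  assumes "P \<subseteq> corona"
  shows "corona_topology closure_of P = {c \<in> corona. corona_close {c} P}"
proof -
  define U where "U = {c \<in> corona. corona_far {c} P}"
  have "corona_far {c} (corona - U)" if c: "c \<in> U" for c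
  proof -
    obtain A B where AB: "A \<subseteq> M" "B \<subseteq> M" "coarsely_disjoint A B" "c \<in> corona_cl A" "P \<subseteq> corona_cl B"
      using c by (auto simp: U_def corona_far_def)
    obtain C D where CD: "C \<subseteq> M" "D \<subseteq> M" "C \<union> D = M" "coarsely_disjoint C A" "coarsely_disjoint D B"
      using coarsely_disjoint_separate AB by metis
    have "corona - U \<subseteq> corona_cl C"
    proof
      fix x assume x: "x \<in> corona - U"
      then obtain H where H: "coarse_ultrafilter H" "x = asymptotically_alike `` {H}"
        unfolding corona_def quotient_def by blast
      then have "H \<in> x"
        by (auto simp: asymptotically_alike_def coarse_ultrafilter_def)
      have "C \<in> H \<or> D \<in> H"
        using H CD unfolding coarse_ultrafilter_def by metis
      moreover have "D \<notin> H"
      proof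
        assume "D \<in> H"
        then have "{x} \<subseteq> corona_cl D"
          using x \<open>H \<in> x\<close> by (auto simp: corona_cl_def)
        then have "corona_far {x} P"
          using AB CD unfolding corona_far_def by blast
        then show False
          using x by (simp add: U_def)
      qed
      ultimately show "x \<in> corona_cl C"
        using x \<open>H \<in> x\<close> by (auto simp: corona_cl_def)
    qed
    moreover have "coarsely_disjoint A C"
      using CD coarsely_disjoint_commute[of A C] by simp
    ultimately show ?thesis
      unfolding corona_far_def using AB CD by blast
  qed
  then have 1: "openin corona_topology U"
    by (auto simp: openin_corona_topology corona_open_alt U_def)
  have 2: "U \<inter> P = {}"
    using corona_far_disjoint by (auto simp: U_def)
  have 3: "corona_far {c} P" if "openin corona_topology V" "c \<in> V" "V \<inter> P = {}" for c V
  proof -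
    have "P \<subseteq> corona - V"
      using that assms by blast
    then show ?thesis
      using that corona_far_mono[of "{c}" "corona - V" "{c}" P]
      by (auto simp: openin_corona_topology corona_open_alt)
  qed
  have 4: "topspace corona_topology = corona"
  proof -
    have "corona_far {c} {}" if c: "c \<in> corona" for c
    proof -
      obtain H where H: "coarse_ultrafilter H" "c = asymptotically_alike `` {H}"
        using c unfolding corona_def quotient_def by blast
      then have "H \<in> c" "M \<in> H"
        by (auto simp: asymptotically_alike_def coarse_ultrafilter_def)
      then have "{c} \<subseteq> corona_cl M"
        using that by (auto simp: corona_cl_def)
      moreover have "coarsely_disjoint M {}"
        by (simp add: coarsely_disjoint_def)
      ultimately show ?thesis
        unfolding corona_far_def by blast
    qed
    then have "corona_open corona"
      by (simp add: corona_open_alt)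
    then have "corona \<subseteq> topspace corona_topology"
      by (simp add: openin_corona_topology openin_subset)
    moreover have "corona_open (topspace corona_topology)"
      using openin_topspace[of corona_topology] by (simp only: openin_corona_topology)
    ultimately show ?thesis
      unfolding corona_open_alt by blast
  qed
  have "c \<in> corona_topology closure_of P \<longleftrightarrow> c \<in> corona \<and> \<not> corona_far {c} P" for c
  proof (cases "corona_far {c} P")
    case True
    have "c \<notin> corona_topology closure_of P"
    proof
      assume c: "c \<in> corona_topology closure_of P"
      then have "c \<in> U"
        using True by (simp add: in_closure_of 4 U_def)
      then show False
        using c 1 2 unfolding in_closure_of by blast
    qed
    with True show ?thesis by simp
  next
    case False
    then show ?thesis
      using 3[of _ c] unfolding in_closure_of 4 by blast
  qed
  then show ?thesis
    by (intro set_eqI) (simp only: mem_Collect_eq)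
qed

end

end

theory Submission
  imports Defs
begin

text \<open>
  Along a coarse ultrafilter \<open>F\<close> every Higson function \<open>\<phi>\<close> has a unique limit: boundedness of
  \<open>\<phi>\<close> gives existence, and sets on which the values of \<open>\<phi>\<close> are a positive distance apart are
  coarsely disjoint, which gives uniqueness. Conversely, coarsely disjoint sets \<open>A\<close>, \<open>B\<close> are
  separated at infinity by the Higson function \<open>d(x,A) / (1 + d(x,A) + d(x,B))\<close>. Hence two coarse
  ultrafilters are asymptotically alike iff they have the same limits, and taking limits embeds
  the corona into the product defining the Higson compactification. A point \<open>p\<close> of the Higson
  corona is the limit of the coarse ultrafilter of all \<open>A\<close> whose image has \<open>p\<close> in its closure;
  properness is used to see that \<open>p\<close> is not in the closure of a bounded set.
\<close>

context Metric_space
begin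

section \<open>Neighbourhoods of bounded sets\<close>

lemma mbounded_neighbourhood:
  assumes "mbounded K"
  shows "mbounded {x \<in> M. \<exists>a\<in>K. d x a \<le> r}"
proof -
  obtain c B where c: "c \<in> M \<or> K = {}" "K \<subseteq> mcball c B"
    using assms unfolding mbounded_def by fastforce
  have "{x \<in> M. \<exists>a\<in>K. d x a \<le> r} \<subseteq> mcball c (B + r)"
  proof clarify
    fix x a assume *: "x \<in> M" "a \<in> K" "d x a \<le> r"
    then have "a \<in> M" "c \<in> M" "d c a \<le> B"
      using c by auto
    then show "x \<in> mcball c (B + r)"
      using * triangle[of c a x] commute[of a x] by simp
  qed
  then show ?thesis
    unfolding mbounded_def by blast
qed

subsection \<open>Coarse ultrafilters\<close>

text \<open>All points related to a bounded set by an entourage lie in a bounded neighbourhood of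
  it, so the intersection is bounded whatever \<open>B\<close> is. With \<open>B = A\<close> this
  keeps bounded sets out of every coarse ultrafilter.\<close>

lemma coarsely_disjoint_mbounded:
  assumes "mbounded A"
  shows "coarsely_disjoint A B"
  unfolding coarsely_disjoint_def
proof (intro allI impI)
  fix E assume E: "entourage E"
  then obtain r where r: "\<And>x y. (x,y) \<in> E \<Longrightarrow> d x y \<le> r"
    by (fastforce simp: entourage_def bdd_above_def)
  show "mbounded (E\<inverse> `` A \<inter> E\<inverse> `` B)"
    by (rule mbounded_subset[OF mbounded_neighbourhood[OF assms, of r]])
      (use r E in \<open>fastforce simp: entourage_def\<close>)
qed

lemma coarse_ultrafilter_not_mbounded:
  "coarse_ultrafilter F \<Longrightarrow> A \<in> F \<Longrightarrow> \<not> mbounded A"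
  using coarsely_disjoint_mbounded coarse_ultrafilter_not_disjoint by blast

lemma coarse_ultrafilter_subset: "coarse_ultrafilter F \<Longrightarrow> A \<in> F \<Longrightarrow> A \<subseteq> M"
  by (auto simp: coarse_ultrafilter_def)

lemma coarse_ultrafilter_Un:
  "coarse_ultrafilter F \<Longrightarrow> A \<union> B \<in> F \<Longrightarrow> A \<in> F \<or> B \<in> F"
  unfolding coarse_ultrafilter_def by (metis PowD le_sup_iff subsetD)

lemma coarse_ultrafilter_UN:
  assumes "coarse_ultrafilter F" "finite I" "(\<Union>i\<in>I. A i) \<in> F"
  shows "\<exists>i\<in>I. A i \<in> F"
  using assms(2,3)
proof (induction I)
  \<comment> \<open>The empty union is bounded, so it cannot belong to \<open>F\<close>.\<close>
  case empty
  then show ?case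
    using coarse_ultrafilter_not_mbounded[OF assms(1)] mbounded_empty by force
next
  case (insert i I)
  then show ?case
    using coarse_ultrafilter_Un[OF assms(1), of "A i" "\<Union>i\<in>I. A i"] by auto
qed

text \<open>The piece \<open>A \<inter> K\<close> is bounded and hence not in \<open>F\<close>, so
  the partition axiom selects the other piece. This allows the behaviour of a function on a bounded
  set to be ignored when taking limits.\<close>

lemma coarse_ultrafilter_Diff_mbounded:
  assumes "coarse_ultrafilter F" "A \<in> F" "mbounded K"
  shows "A - K \<in> F"
proof -
  have "A \<inter> K \<notin> F"
    using coarse_ultrafilter_not_mbounded[OF assms(1)] assms(3) mbounded_subset by blast
  moreover have "(A \<inter> K) \<union> (A - K) \<in> F"
    using assms(2) by (simp add: Int_Diff_Un)
  ultimately show ?thesis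
    using coarse_ultrafilter_Un[OF assms(1)] by blast
qed

lemma asymptotically_alike_iff:
  "(F, G) \<in> asymptotically_alike \<longleftrightarrow>
     coarse_ultrafilter F \<and> coarse_ultrafilter G \<and> (\<forall>A\<in>F. \<forall>B\<in>G. close A B)"
  by (simp add: asymptotically_alike_def)

lemma asymptotically_alike_refl:
  "coarse_ultrafilter F \<Longrightarrow> (F, F) \<in> asymptotically_alike"
  unfolding asymptotically_alike_iff using coarse_ultrafilter_not_disjoint[of F] by blast

lemma corona_cases:
  assumes "c \<in> corona"
  obtains H where "coarse_ultrafilter H" "H \<in> c" "c = asymptotically_alike `` {H}"
proof -
  obtain H where H: "coarse_ultrafilter H" "c = asymptotically_alike `` {H}"
    using assms unfolding corona_def quotient_def by blast
  then have "H \<in> c"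
    using asymptotically_alike_refl by blast
  with H show thesis
    using that by blast
qed

lemma mem_coronaD: "c \<in> corona \<Longrightarrow> F \<in> c \<Longrightarrow> coarse_ultrafilter F"
  by (auto simp: corona_def quotient_def asymptotically_alike_iff)

lemma topspace_corona_topology [simp]: "topspace corona_topology = corona"
proof
  show "topspace corona_topology \<subseteq> corona"
    using openin_topspace[of corona_topology]
    unfolding openin_corona_topology corona_open_alt by blast
  \<comment> \<open>A class far from a set lies outside it, so no class is far from the whole
    corona.\<close>
  have "corona \<subseteq> corona_topology closure_of corona"
    unfolding closure_of_corona_topology[OF subset_refl] using corona_far_disjoint by blast
  then show "corona \<subseteq> topspace corona_topology"
    by (rule subset_trans[OF _ closure_of_subset_topspace])
qed

subsection \<open>Higson functions\<close>

text \<open>If \<open>x\<close> is within \<open>r\<close> of both \<open>a\<close> and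
  \<open>b\<close>, then \<open>a\<close> and \<open>b\<close> are at most \<open>2 * r\<close>
  apart. As their values differ by at least \<open>\<delta>\<close>, the variation condition puts
  one of them into a bounded set \<open>K\<close>, so \<open>x\<close> is within \<open>r\<close> of
  \<open>K\<close>.\<close>

lemma higson_function_coarsely_disjoint:
  assumes \<phi>: "\<phi> \<in> higson_functions" and AB: "A \<subseteq> M" "B \<subseteq> M"
    and \<delta>: "\<delta> > 0" "\<And>a b. a \<in> A \<Longrightarrow> b \<in> B \<Longrightarrow> \<delta> \<le> dist (\<phi> a) (\<phi> b)"
  shows "coarsely_disjoint A B"
  unfolding coarsely_disjoint_alt[OF AB]
proof
  fix r :: real
  \<comment> \<open>The maximum with 1 makes the scale positive, as the Higson condition demands,
    for every real \<open>r\<close>.\<close>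
  define R where "R = max 1 (2 * r)"
  have "R > 0" by (simp add: R_def)
  then have "\<exists>K. mbounded K \<and>
      (\<forall>x\<in>M - K. \<forall>y\<in>M - K. d x y \<le> R \<longrightarrow> norm (\<phi> x - \<phi> y) < \<delta>)"
    using \<phi> \<delta>(1) by (simp add: higson_functions_def)
  then obtain K where K: "mbounded K"
      "\<And>x y. x \<in> M - K \<Longrightarrow> y \<in> M - K \<Longrightarrow> d x y \<le> R \<Longrightarrow> norm (\<phi> x - \<phi> y) < \<delta>"
    by blast
  show "mbounded {x\<in>M. (\<exists>a\<in>A. d x a \<le> r) \<and> (\<exists>b\<in>B. d x b \<le> r)}"
  proof (rule mbounded_subset[OF mbounded_neighbourhood[OF K(1), of r]], clarsimp)
    fix x a b assume *: "x \<in> M" "a \<in> A" "d x a \<le> r" "b \<in> B" "d x b \<le> r"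
    then have "a \<in> M" "b \<in> M" using AB by auto
    then have "d a b \<le> R"
      using * triangle[of a x b] commute[of a x] by (simp add: R_def)
    then have "a \<in> K \<or> b \<in> K"
      using K(2)[of a b] \<delta>(2)[of a b] * \<open>a \<in> M\<close> \<open>b \<in> M\<close> by (force simp: dist_norm)
    then show "\<exists>a\<in>K. d x a \<le> r"
      using * by blast
  qed
qed

text \<open>The constant \<open>L\<close> is there to yield continuity; for functions built from
  distances it comes from the triangle inequality.\<close>

lemma higson_functions_I:
  fixes f :: "'a \<Rightarrow> real"
  assumes "\<And>x. x \<in> M \<Longrightarrow> \<bar>f x\<bar> \<le> B"
    and lip: "\<And>x y. x \<in> M \<Longrightarrow> y \<in> M \<Longrightarrow> \<bar>f x - f y\<bar> \<le> L * d x y"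
    and K: "\<And>R \<epsilon>. R > 0 \<Longrightarrow> \<epsilon> > 0 \<Longrightarrow> \<exists>K. mbounded K \<and>
      (\<forall>x\<in>M - K. \<forall>y\<in>M - K. d x y \<le> R \<longrightarrow> \<bar>f x - f y\<bar> < \<epsilon>)"
  shows "(\<lambda>x\<in>M. complex_of_real (f x)) \<in> higson_functions"
proof -
  have "Lipschitz_continuous_map Self euclidean_metric f"
    unfolding Lipschitz_continuous_map_def using lip
    by (auto simp: dist_real_def)
  then have "continuous_map mtopology euclideanreal f"
    using Lipschitz_continuous_imp_continuous_map[of Self euclidean_metric f]
    by (simp add: mtopology_of_def)
  moreover have "continuous_map euclideanreal euclidean complex_of_real"
    by (auto intro: continuous_intros)
  ultimately have "continuous_map mtopology euclidean (complex_of_real \<circ> f)"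
    by (rule continuous_map_compose)
  then have "continuous_map mtopology euclidean (\<lambda>x\<in>M. complex_of_real (f x))"
    by (rule continuous_map_eq) auto
  moreover have "bounded ((\<lambda>x\<in>M. complex_of_real (f x)) ` M)"
    using assms(1) by (auto simp: bounded_iff)
  moreover have "norm (complex_of_real a - complex_of_real b) = \<bar>a - b\<bar>" for a b
    by (metis norm_of_real of_real_diff)
  ultimately show ?thesis
    using K unfolding higson_functions_def by simp
qed

text \<open>Serves to tell corona points from points of \<open>M\<close>: the bump is 1 at
  \<open>x\<close> but is supported in a bounded set, so it cannot tend to 1 along a coarse
  ultrafilter.\<close>

lemma higson_function_bump:
  assumes "x \<in> M"
  shows "(\<lambda>y\<in>M. complex_of_real (max 0 (1 - d x y))) \<in> higson_functions"
proof (rule higson_functions_I[where B = 1 and L = 1])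
  fix y assume "y \<in> M"
  then show "\<bar>max 0 (1 - d x y)\<bar> \<le> 1"
    by simp
next
  fix y z assume "y \<in> M" "z \<in> M"
  then show "\<bar>max 0 (1 - d x y) - max 0 (1 - d x z)\<bar> \<le> 1 * d y z"
    using assms triangle[of x y z] triangle[of x z y] commute[of y z] by (auto simp: max_def)
next
  fix R \<epsilon> :: real assume "\<epsilon> > 0"
  \<comment> \<open>Outside the closed unit ball both values are 0, so one bounded set serves all
    \<open>R\<close> and \<open>\<epsilon>\<close>.\<close>
  have "\<bar>max 0 (1 - d x y) - max 0 (1 - d x z)\<bar> < \<epsilon>"
    if "y \<in> M - mcball x 1" "z \<in> M - mcball x 1" for y z
    using that assms \<open>\<epsilon> > 0\<close> by auto
  then show "\<exists>K. mbounded K \<and> (\<forall>y\<in>M - K. \<forall>z\<in>M - K. d y z \<le> R \<longrightarrow>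
      \<bar>max 0 (1 - d x y) - max 0 (1 - d x z)\<bar> < \<epsilon>)"
    using mbounded_mcball by blast
qed

section \<open>Separating coarsely disjoint sets by a Higson function\<close>

definition set_distance :: "'a set \<Rightarrow> 'a \<Rightarrow> real" where
  "set_distance A x = (INF a\<in>A. d x a)"

text \<open>The infimum need not be attained, hence the slack in \<open>r + 1\<close>; over the
  reals it has no intended value for empty \<open>A\<close>, hence
  \<open>A \<noteq> {}\<close>.\<close>

lemma set_distance:
  assumes A: "A \<subseteq> M" "A \<noteq> {}"
  shows "set_distance A x \<ge> 0"
    and "a \<in> A \<Longrightarrow> set_distance A a = 0"
    and "x \<in> M \<Longrightarrow> y \<in> M \<Longrightarrow> \<bar>set_distance A x - set_distance A y\<bar> \<le> d x y"
    and "set_distance A x \<le> r \<Longrightarrow> \<exists>a\<in>A. d x a \<le> r + 1"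
proof -
  let ?f = "set_distance A"
  have bdd: "bdd_below (d x ` A)" for x
    by (rule bdd_belowI2[of _ 0]) simp
  show nonneg_f: "?f x \<ge> 0" for x
    unfolding set_distance_def using A by (intro cINF_greatest) auto
  show "?f a = 0" if "a \<in> A"
    using cINF_lower[OF bdd[of a] that] nonneg_f[of a] A that by (auto simp: set_distance_def)
  have le: "?f x \<le> d x y + ?f y" if "x \<in> M" "y \<in> M" for x y
  proof -
    have "?f x - d x y \<le> ?f y"
      unfolding set_distance_def
    proof (rule cINF_greatest[OF A(2)])
      fix a assume "a \<in> A"
      then show "(INF a\<in>A. d x a) - d x y \<le> d y a"
        using cINF_lower[OF bdd[of x], of a] triangle[of x y a] that A by force
    qed
    then show ?thesis by simp
  qed
  show "\<bar>?f x - ?f y\<bar> \<le> d x y" if "x \<in> M" "y \<in> M"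
    using le[OF that] le[OF that(2,1)] commute[of x y] by linarith
  show "\<exists>a\<in>A. d x a \<le> r + 1" if "?f x \<le> r"
  proof -
    have "(INF a\<in>A. d x a) < r + 1"
      using that by (simp add: set_distance_def)
    then show ?thesis
      using cINF_less_iff[OF A(2) bdd] less_imp_le by blast
  qed
qed

text \<open>Over the common denominator \<open>s * s'\<close> the numerator is at most
  \<open>3 * D * s'\<close>, because \<open>f' \<le> s'\<close> and the two denominators differ by
  at most \<open>2 * D\<close>. Cancelling \<open>s'\<close> leaves a bound that decays as
  \<open>f + g\<close> grows.\<close>

lemma quotient_variation:
  fixes f g f' g' D :: real
  assumes "f \<ge> 0" "g \<ge> 0" "f' \<ge> 0" "g' \<ge> 0" "\<bar>f - f'\<bar> \<le> D" "\<bar>g - g'\<bar> \<le> D"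
  shows "\<bar>f / (1 + f + g) - f' / (1 + f' + g')\<bar> \<le> 3 * D / (1 + f + g)"
proof -
  define s s' where "s = 1 + f + g" and "s' = 1 + f' + g'"
  have pos: "s > 0" "s' > 0" "f' \<le> s'" and D: "\<bar>s' - s\<bar> \<le> 2 * D" "D \<ge> 0"
    using assms by (auto simp: s_def s'_def)
  have "f / s - f' / s' = ((f - f') * s' + f' * (s' - s)) / (s * s')"
    using pos by (simp add: field_simps)
  then have "\<bar>f / s - f' / s'\<bar> = \<bar>(f - f') * s' + f' * (s' - s)\<bar> / (s * s')"
    using pos by (simp add: abs_mult)
  also have "\<bar>(f - f') * s' + f' * (s' - s)\<bar> \<le> D * s' + s' * (2 * D)"
  proof -
    have "\<bar>(f - f') * s'\<bar> \<le> D * s'"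
      using assms pos by (simp add: abs_mult mult_right_mono)
    moreover have "\<bar>f' * (s' - s)\<bar> \<le> s' * (2 * D)"
      unfolding abs_mult using assms pos D by (intro mult_mono) auto
    ultimately show ?thesis by linarith
  qed
  also have "(D * s' + s' * (2 * D)) / (s * s') = 3 * D / s"
    using pos by (simp add: field_simps)
  finally show ?thesis
    using pos by (simp add: s_def s'_def divide_right_mono)
qed

text \<open>On \<open>B\<close> the quotient is \<open>f / (1 + f)\<close>, which is at least
  \<open>1 / 2\<close> once \<open>f\<close> reaches 1. The points of \<open>B\<close> where
  \<open>f\<close> is smaller are close to both sets; they are bounded and go into
  \<open>K\<close>.\<close>

lemma higson_function_separating:
  assumes AB: "A \<subseteq> M" "B \<subseteq> M" "coarsely_disjoint A B"
  obtains \<phi> K where "\<phi> \<in> higson_functions" "mbounded K"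
    "\<And>x. x \<in> A \<Longrightarrow> \<phi> x = 0" "\<And>x. x \<in> B - K \<Longrightarrow> norm (\<phi> x) \<ge> 1 / 2"
proof (cases "A = {} \<or> B = {}")
  case True
  \<comment> \<open>Distances to an empty set are meaningless, so a constant is used: 1 if
    \<open>A\<close> is empty, and 0 otherwise, when \<open>B\<close> is empty.\<close>
  define f :: "'a \<Rightarrow> real" where "f = (\<lambda>x. if A = {} then 1 else 0)"
  have "(\<lambda>x\<in>M. complex_of_real (f x)) \<in> higson_functions"
    by (rule higson_functions_I[where B = 1 and L = 1])
      (auto simp: f_def intro: exI[of _ "{}"])
  then show ?thesis
    by (rule that[of _ "{}"]) (use True AB in \<open>auto simp: f_def\<close>)
next
  case False
  define f g where "f = set_distance A" and "g = set_distance B"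
  define h where "h = (\<lambda>x. f x / (1 + f x + g x))"
  note f = set_distance[OF AB(1), folded f_def] and g = set_distance[OF AB(2), folded g_def]
  have nonneg_fg: "f x \<ge> 0" "g x \<ge> 0" for x
    using f(1) g(1) False by auto
  have var: "\<bar>h x - h y\<bar> \<le> 3 * d x y / (1 + f x + g x)" if "x \<in> M" "y \<in> M" for x y
    unfolding h_def using that False by (intro quotient_variation f g) auto
  \<comment> \<open>A point of \<open>K r\<close> is within \<open>r + 1\<close> of both
    \<open>A\<close> and \<open>B\<close>, so coarse disjointness bounds \<open>K r\<close>.\<close>
  define K where "K = (\<lambda>r. {x \<in> M. f x + g x \<le> r})"
  have K: "mbounded (K r)" for r
  proof (rule mbounded_subset)
    show "mbounded {x \<in> M. (\<exists>a\<in>A. d x a \<le> r + 1) \<and> (\<exists>b\<in>B. d x b \<le> r + 1)}"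
      using AB coarsely_disjoint_alt by blast
    show "K r \<subseteq> \<dots>"
    proof
      fix x assume "x \<in> K r"
      then have "x \<in> M" "f x \<le> r" "g x \<le> r"
        using nonneg_fg[of x] by (auto simp: K_def)
      then show "x \<in> {x \<in> M. (\<exists>a\<in>A. d x a \<le> r + 1) \<and> (\<exists>b\<in>B. d x b \<le> r + 1)}"
        using f(4) g(4) False by blast
    qed
  qed
  have "(\<lambda>x\<in>M. complex_of_real (h x)) \<in> higson_functions"
  proof (rule higson_functions_I[where B = 1 and L = 3])
    fix x
    show "\<bar>h x\<bar> \<le> 1"
      using nonneg_fg[of x] by (simp add: h_def)
  next
    fix x y assume "x \<in> M" "y \<in> M"
    then have "\<bar>h x - h y\<bar> \<le> 3 * d x y / (1 + f x + g x)"
      by (rule var)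
    also have "\<dots> \<le> 3 * d x y / 1"
      using nonneg_fg[of x] by (intro divide_left_mono) auto
    finally show "\<bar>h x - h y\<bar> \<le> 3 * d x y"
      by simp
  next
    fix R \<epsilon> :: real assume pos: "R > 0" "\<epsilon> > 0"
    \<comment> \<open>The radius \<open>3 * R / \<epsilon>\<close> is chosen so that outside this
      set the denominator beats \<open>3 * R / \<epsilon>\<close>.\<close>
    have "\<bar>h x - h y\<bar> < \<epsilon>"
      if xy: "x \<in> M - K (3 * R / \<epsilon>)" "y \<in> M - K (3 * R / \<epsilon>)" "d x y \<le> R" for x y
    proof -
      have "\<bar>h x - h y\<bar> \<le> 3 * d x y / (1 + f x + g x)"
        using var xy by blast
      also have "\<dots> \<le> 3 * R / (1 + f x + g x)"
        using xy nonneg_fg[of x] by (intro divide_right_mono) auto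
      also have "\<dots> < \<epsilon>"
      proof -
        have "3 * R / \<epsilon> < 1 + f x + g x"
          using xy by (auto simp: K_def)
        then have "3 * R < (1 + f x + g x) * \<epsilon>"
          using pos by (simp add: pos_divide_less_eq)
        then show ?thesis
          using nonneg_fg[of x] by (simp add: pos_divide_less_eq mult.commute)
      qed
      finally show ?thesis .
    qed
    then show "\<exists>K. mbounded K \<and>
        (\<forall>x\<in>M - K. \<forall>y\<in>M - K. d x y \<le> R \<longrightarrow> \<bar>h x - h y\<bar> < \<epsilon>)"
      using K by blast
  qed
  then show ?thesis
  proof (rule that[OF _ K])
    fix x assume "x \<in> A"
    then show "(\<lambda>x\<in>M. complex_of_real (h x)) x = 0"
      using f(2) AB by (auto simp: h_def)
  next
    fix x assume x: "x \<in> B - K 1"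
    then have "g x = 0" "x \<in> M"
      using g(2) AB by auto
    moreover from this have "f x > 1"
      using x by (simp add: K_def)
    ultimately have "h x \<ge> 1 / 2"
      by (simp add: h_def)
    then show "norm ((\<lambda>x\<in>M. complex_of_real (h x)) x) \<ge> 1 / 2"
      using \<open>x \<in> M\<close> by simp
  qed
qed

subsection \<open>Limits of Higson functions along coarse ultrafilters\<close>

text \<open>A coarse ultrafilter need not be closed under intersections, so the limit is spelled out
  instead of being taken along a filter.\<close>

definition higson_lim :: "'a set set \<Rightarrow> ('a \<Rightarrow> complex) \<Rightarrow> complex" where
  "higson_lim F \<phi> = (SOME z. \<forall>e>0. {x \<in> M. dist (\<phi> x) z < e} \<in> F)"

text \<open>Otherwise every \<open>z\<close> has a ball whose preimage is not in \<open>F\<close>.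
  Finitely many of these balls cover the compact closure of the range, so \<open>M\<close> would be
  a finite union of sets outside \<open>F\<close>.\<close>

lemma higson_lim:
  assumes F: "coarse_ultrafilter F" and \<phi>: "\<phi> \<in> higson_functions" and "e > 0"
  shows "{x \<in> M. dist (\<phi> x) (higson_lim F \<phi>) < e} \<in> F"
proof -
  have "\<exists>z. \<forall>e>0. {x \<in> M. dist (\<phi> x) z < e} \<in> F"
  proof (rule ccontr)
    assume "\<nexists>z. \<forall>e>0. {x \<in> M. dist (\<phi> x) z < e} \<in> F"
    then obtain e where e: "\<And>z. e z > 0" "\<And>z. {x \<in> M. dist (\<phi> x) z < e z} \<notin> F"
      by metis
    have "compact (closure (\<phi> ` M))"
      using \<phi> by (auto simp: higson_functions_def compact_closure)
    moreover have "closure (\<phi> ` M) \<subseteq> (\<Union>z\<in>UNIV. ball z (e z))"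
    proof
      fix z
      show "z \<in> (\<Union>z\<in>UNIV. ball z (e z))"
        using e(1)[of z] by (intro UN_I[of z]) auto
    qed
    ultimately obtain T where T: "finite T" "closure (\<phi> ` M) \<subseteq> (\<Union>z\<in>T. ball z (e z))"
      using compactE_image[of "closure (\<phi> ` M)" UNIV "\<lambda>z. ball z (e z)"] by auto
    have "M = (\<Union>z\<in>T. {x \<in> M. dist (\<phi> x) z < e z})"
      using T(2) closure_subset[of "\<phi> ` M"] by (fastforce simp: dist_commute)
    moreover have "M \<in> F"
      using F by (simp add: coarse_ultrafilter_def)
    ultimately have "(\<Union>z\<in>T. {x \<in> M. dist (\<phi> x) z < e z}) \<in> F"
      by simp
    then show False
      using coarse_ultrafilter_UN[OF F T(1)] e(2) by blast
  qed
  then show ?thesis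
    unfolding higson_lim_def by (rule someI2_ex) (use \<open>e > 0\<close> in blast)
qed

text \<open>Otherwise the set where \<phi> is within \<open>e / 2\<close> of its limit along
  \<open>F\<close> would be coarsely disjoint from \<open>A\<close>, although it lies in
  \<open>F\<close>. The case \<open>F = G\<close> puts the limit into the closure of the values on
  each member.\<close>

lemma asymptotically_alike_lim_near:
  assumes FG: "(F, G) \<in> asymptotically_alike" and \<phi>: "\<phi> \<in> higson_functions"
    and "A \<in> G" "e > 0"
  shows "\<exists>a\<in>A. dist (\<phi> a) (higson_lim F \<phi>) < e"
proof (rule ccontr)
  assume "\<not> (\<exists>a\<in>A. dist (\<phi> a) (higson_lim F \<phi>) < e)"
  then have A: "dist (\<phi> a) (higson_lim F \<phi>) \<ge> e" if "a \<in> A" for a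
    using that by force
  have F: "coarse_ultrafilter F" "coarse_ultrafilter G"
    using FG by (auto simp: asymptotically_alike_iff)
  define B where "B = {x \<in> M. dist (\<phi> x) (higson_lim F \<phi>) < e / 2}"
  have "B \<in> F"
    unfolding B_def using F \<phi> \<open>e > 0\<close> by (intro higson_lim) auto
  moreover have "coarsely_disjoint B A"
  proof (rule higson_function_coarsely_disjoint[OF \<phi>, of _ _ "e / 2"])
    show "A \<subseteq> M"
      using F(2) \<open>A \<in> G\<close> by (rule coarse_ultrafilter_subset)
    fix b a assume "b \<in> B" "a \<in> A"
    then show "e / 2 \<le> dist (\<phi> b) (\<phi> a)"
      using A[of a] dist_triangle2[of "\<phi> a" "higson_lim F \<phi>" "\<phi> b"]
      by (simp add: B_def dist_commute)
  qed (use \<open>e > 0\<close> in \<open>auto simp: B_def\<close>)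
  ultimately show False
    using FG \<open>A \<in> G\<close> unfolding asymptotically_alike_iff by blast
qed

lemma higson_lim_in_closure:
  assumes "coarse_ultrafilter F" "\<phi> \<in> higson_functions" "A \<in> F"
  shows "higson_lim F \<phi> \<in> closure (\<phi> ` A)"
  using asymptotically_alike_lim_near[OF asymptotically_alike_refl[OF assms(1)] assms(2,3)]
  by (auto simp: closure_approachable)

lemma asymptotically_alike_higson_lim:
  assumes FG: "(F, G) \<in> asymptotically_alike" and \<phi>: "\<phi> \<in> higson_functions"
  shows "higson_lim F \<phi> = higson_lim G \<phi>"
proof -
  have "dist (higson_lim F \<phi>) (higson_lim G \<phi>) < e" if e: "e > 0" for e
  proof -
    define A where "A = {x \<in> M. dist (\<phi> x) (higson_lim G \<phi>) < e / 2}"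
    have "A \<in> G"
      unfolding A_def using FG \<phi> that
      by (intro higson_lim) (auto simp: asymptotically_alike_iff)
    then obtain a where "a \<in> A" "dist (\<phi> a) (higson_lim F \<phi>) < e / 2"
      using asymptotically_alike_lim_near[OF FG \<phi>, of A "e / 2"] e by auto
    then show ?thesis
      using dist_triangle_half_r[of "\<phi> a" "higson_lim F \<phi>" e "higson_lim G \<phi>"]
      by (simp add: A_def)
  qed
  \<comment> \<open>With \<open>e\<close> equal to the distance itself, a positive distance would be
    less than itself.\<close>
  from this[of "dist (higson_lim F \<phi>) (higson_lim G \<phi>)"] show ?thesis
    by auto
qed

text \<open>Both conditions on values are closed, so they pass to the limit; removing
  \<open>K\<close> is harmless because \<open>A - K\<close> stays in \<open>F\<close>.\<close>

lemma higson_lim_separating: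
  assumes F: "coarse_ultrafilter F" and \<phi>: "\<phi> \<in> higson_functions" and "A \<in> F" "mbounded K"
  shows "(\<And>x. x \<in> A \<Longrightarrow> \<phi> x = 0) \<Longrightarrow> higson_lim F \<phi> = 0"
    and "(\<And>x. x \<in> A - K \<Longrightarrow> norm (\<phi> x) \<ge> 1 / 2) \<Longrightarrow> norm (higson_lim F \<phi>) \<ge> 1 / 2"
proof -
  assume "\<And>x. x \<in> A \<Longrightarrow> \<phi> x = 0"
  then have "closure (\<phi> ` A) \<subseteq> closure {0}"
    by (intro closure_mono) auto
  then show "higson_lim F \<phi> = 0"
    using higson_lim_in_closure[OF F \<phi> \<open>A \<in> F\<close>] by auto
next
  assume "\<And>x. x \<in> A - K \<Longrightarrow> norm (\<phi> x) \<ge> 1 / 2"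
  moreover have "closed {z :: complex. norm z \<ge> 1 / 2}"
    by (intro closed_Collect_le continuous_intros)
  ultimately have "closure (\<phi> ` (A - K)) \<subseteq> {z. norm z \<ge> 1 / 2}"
    by (intro closure_minimal) auto
  then show "norm (higson_lim F \<phi>) \<ge> 1 / 2"
    using higson_lim_in_closure[OF F \<phi> coarse_ultrafilter_Diff_mbounded[OF F \<open>A \<in> F\<close> \<open>mbounded K\<close>]]
    by blast
qed

text \<open>For the converse, a function separating coarsely disjoint members of \<open>F\<close>
  and \<open>G\<close> has limit 0 along \<open>F\<close> but a limit of norm at least
  \<open>1 / 2\<close> along \<open>G\<close>.\<close>

lemma asymptotically_alike_iff_higson_lim:
  "(F, G) \<in> asymptotically_alike \<longleftrightarrow> coarse_ultrafilter F \<and> coarse_ultrafilter G \<and>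
     (\<forall>\<phi>\<in>higson_functions. higson_lim F \<phi> = higson_lim G \<phi>)" (is "?L \<longleftrightarrow> ?R")
proof
  assume ?L
  then show ?R
    using asymptotically_alike_higson_lim by (auto simp: asymptotically_alike_iff)
next
  assume R: ?R
  have "close A B" if "A \<in> F" "B \<in> G" for A B
  proof
    assume "coarsely_disjoint A B"
    moreover have "A \<subseteq> M" "B \<subseteq> M"
      using that R coarse_ultrafilter_subset by blast+
    ultimately obtain \<phi> K where \<phi>: "\<phi> \<in> higson_functions" "mbounded K"
        "\<And>x. x \<in> A \<Longrightarrow> \<phi> x = 0" "\<And>x. x \<in> B - K \<Longrightarrow> norm (\<phi> x) \<ge> 1 / 2"
      using higson_function_separating by metis
    then have "higson_lim F \<phi> = 0" "norm (higson_lim G \<phi>) \<ge> 1 / 2"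
      using R that higson_lim_separating by auto
    then show False
      using R \<phi>(1) by auto
  qed
  then show ?L
    using R by (simp add: asymptotically_alike_iff)
qed

subsection \<open>The limit map from the corona to the Higson corona\<close>

text \<open>The restriction makes the value a point of the product; alike ultrafilters have equal
  limits, so the representative does not matter.\<close>

definition corona_point :: "'a set set set \<Rightarrow> ('a \<Rightarrow> complex) \<Rightarrow> complex" where
  "corona_point c = (\<lambda>\<phi>\<in>higson_functions. higson_lim (SOME F. F \<in> c) \<phi>)"

lemma corona_point:
  assumes "c \<in> corona" "F \<in> c" "\<phi> \<in> higson_functions"
  shows "corona_point c \<phi> = higson_lim F \<phi>"
proof -
  obtain H where "c = asymptotically_alike `` {H}"
    using assms(1) by (rule corona_cases)
  then have "higson_lim G \<phi> = higson_lim H \<phi>" if "G \<in> c" for G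
    using that assms(3) asymptotically_alike_higson_lim[of H G \<phi>] by simp
  moreover have "(SOME F. F \<in> c) \<in> c"
    using assms(2) by (rule someI)
  ultimately show ?thesis
    using assms(2,3) by (simp add: corona_point_def)
qed

lemma inj_on_corona_point: "inj_on corona_point corona"
proof (rule inj_onI)
  fix b c assume *: "b \<in> corona" "c \<in> corona" "corona_point b = corona_point c"
  obtain F G where F: "coarse_ultrafilter F" "F \<in> b" "b = asymptotically_alike `` {F}"
    and G: "coarse_ultrafilter G" "G \<in> c" "c = asymptotically_alike `` {G}"
    using corona_cases * by metis
  have "higson_lim F \<phi> = higson_lim G \<phi>" if "\<phi> \<in> higson_functions" for \<phi>
    using corona_point * F(2) G(2) that by metis
  then show "b = c"
    unfolding F(3) G(3) using F(1) G(1) by (auto simp: asymptotically_alike_iff_higson_lim)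
qed

section \<open>The Higson corona as a subspace of the product\<close>

abbreviation higson_product :: "(('a \<Rightarrow> complex) \<Rightarrow> complex) topology" where
  "higson_product \<equiv> product_topology (\<lambda>_. euclidean) higson_functions"

lemma higson_corona_eq:
  "higson_corona =
    subtopology higson_product (higson_product closure_of (higson_eval ` M) - higson_eval ` M)"
proof -
  have "topspace higson_compactification = higson_product closure_of (higson_eval ` M)"
    unfolding higson_compactification_def Let_def topspace_subtopology
    using closure_of_subset_topspace[of higson_product "higson_eval ` M"] by blast
  then show ?thesis
    unfolding higson_corona_def
    by (simp add: higson_compactification_def Let_def subtopology_subtopology Int_absorb1)
qed

lemma topspace_higson_corona:
  "topspace higson_corona = higson_product closure_of (higson_eval ` M) - higson_eval ` M"
  unfolding higson_corona_eq topspace_subtopology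
  using closure_of_subset_topspace[of higson_product "higson_eval ` M"] by blast

lemma continuous_map_higson_eval: "continuous_map mtopology higson_product higson_eval"
  unfolding continuous_map_componentwise
proof (intro conjI ballI)
  show "higson_eval ` topspace mtopology \<subseteq> extensional higson_functions"
    by (auto simp: higson_eval_def)
  fix \<phi> assume "\<phi> \<in> higson_functions"
  then show "continuous_map mtopology euclidean (\<lambda>x. higson_eval x \<phi>)"
    by (simp add: higson_eval_def higson_functions_def)
qed

text \<open>
  Properness enters the proof only here: the image of a closed bounded set is compact, hence
  closed in the product, so it contains the closure of the image of \<open>K\<close> and misses \<open>p\<close>.
\<close>

lemma proper_metric_closure_of_higson_eval:
  assumes proper: proper_metric and p: "p \<in> topspace higson_corona" and K: "mbounded K"
    and A: "A \<subseteq> M" "p \<in> higson_product closure_of (higson_eval ` A)"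
  shows "p \<in> higson_product closure_of (higson_eval ` (A - K))"
proof -
  define C where "C = mtopology closure_of K"
  have "compactin mtopology C"
    using proper K unfolding proper_metric_def C_def by (simp add: mbounded_closure_of)
  then have "compactin higson_product (higson_eval ` C)"
    using image_compactin continuous_map_higson_eval by blast
  moreover have "Hausdorff_space higson_product"
    by (simp add: Hausdorff_space_product_topology)
  ultimately have closed: "closedin higson_product (higson_eval ` C)"
    using compactin_imp_closedin by blast
  have "C \<subseteq> M"
    unfolding C_def by (metis closure_of_subset_topspace topspace_mtopology)
  have "A \<inter> K \<subseteq> C"
    using A closure_of_subset_Int[of mtopology K] by (auto simp: C_def)
  then have "higson_product closure_of (higson_eval ` (A \<inter> K)) \<subseteq> higson_eval ` C"
    using closed by (intro closure_of_minimal) auto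
  then have "p \<notin> higson_product closure_of (higson_eval ` (A \<inter> K))"
    using p \<open>C \<subseteq> M\<close> by (auto simp: topspace_higson_corona)
  moreover have "higson_eval ` A = higson_eval ` (A \<inter> K) \<union> higson_eval ` (A - K)"
    by blast
  ultimately show ?thesis
    using A(2) by simp
qed

lemma closure_of_higson_eval_component:
  assumes "p \<in> higson_product closure_of (higson_eval ` A)" "\<phi> \<in> higson_functions"
  shows "p \<phi> \<in> closure (\<phi> ` A)"
proof -
  have "continuous_map higson_product euclidean (\<lambda>p. p \<phi>)"
    using assms(2) by (rule continuous_map_product_projection)
  then have "p \<phi> \<in> euclidean closure_of ((\<lambda>p. p \<phi>) ` higson_eval ` A)"
    using assms(1) continuous_map_image_closure_subset by blast
  moreover have "(\<lambda>p. p \<phi>) ` higson_eval ` A = \<phi> ` A"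
    using assms(2) by (simp add: image_image higson_eval_def)
  ultimately show ?thesis
    by simp
qed

text \<open>A basic neighbourhood restricts finitely many coordinates. The points violating one
  restriction form a set outside \<open>F\<close>, so finitely many such sets do not exhaust
  \<open>M\<close>, and any remaining point evaluates into the neighbourhood. The bump function
  excludes the image of \<open>M\<close>.\<close>

lemma corona_point_in_higson_corona:
  assumes "c \<in> corona"
  shows "corona_point c \<in> topspace higson_corona"
  unfolding topspace_higson_corona
proof
  obtain F where F: "coarse_ultrafilter F" "F \<in> c"
    using assms corona_cases by metis
  note lim = corona_point[OF assms F(2)]
  show "corona_point c \<in> higson_product closure_of (higson_eval ` M)"
    unfolding in_closure_of
  proof (intro conjI allI impI)
    show "corona_point c \<in> topspace higson_product"
      by (simp add: corona_point_def)
    fix T assume "corona_point c \<in> T \<and> openin higson_product T"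
    then obtain U where U: "finite {\<phi> \<in> higson_functions. U \<phi> \<noteq> UNIV}"
        "\<And>\<phi>. \<phi> \<in> higson_functions \<Longrightarrow> open (U \<phi>)"
        "corona_point c \<in> Pi\<^sub>E higson_functions U" "Pi\<^sub>E higson_functions U \<subseteq> T"
      by (force simp: openin_product_topology_alt)
    define I where "I = {\<phi> \<in> higson_functions. U \<phi> \<noteq> UNIV}"
    have "{x \<in> M. \<phi> x \<notin> U \<phi>} \<notin> F" if "\<phi> \<in> I" for \<phi>
    proof
      have \<phi>: "\<phi> \<in> higson_functions"
        using that by (simp add: I_def)
      assume "{x \<in> M. \<phi> x \<notin> U \<phi>} \<in> F"
      then have "higson_lim F \<phi> \<in> closure (\<phi> ` {x \<in> M. \<phi> x \<notin> U \<phi>})"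
        using F(1) \<phi> higson_lim_in_closure by blast
      also have "\<dots> \<subseteq> - U \<phi>"
        using U(2)[OF \<phi>] by (intro closure_minimal) auto
      finally show False
        using U(3) \<phi> lim[OF \<phi>] by (force simp: PiE_iff)
    qed
    then have "(\<Union>\<phi>\<in>I. {x \<in> M. \<phi> x \<notin> U \<phi>}) \<notin> F"
      using coarse_ultrafilter_UN[OF F(1)] U(1) unfolding I_def by blast
    moreover have "M \<in> F"
      using F(1) by (simp add: coarse_ultrafilter_def)
    ultimately have "(\<Union>\<phi>\<in>I. {x \<in> M. \<phi> x \<notin> U \<phi>}) \<noteq> M"
      by metis
    then obtain x where x: "x \<in> M" "\<And>\<phi>. \<phi> \<in> I \<Longrightarrow> \<phi> x \<in> U \<phi>"
      by blast
    \<comment> \<open>Coordinates outside \<open>I\<close> impose nothing, since there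
      \<open>U \<phi>\<close> is everything.\<close>
    then have "higson_eval x \<in> Pi\<^sub>E higson_functions U"
      unfolding higson_eval_def I_def by auto
    then show "\<exists>y. y \<in> higson_eval ` M \<and> y \<in> T"
      using x(1) U(4) by blast
  qed
  show "corona_point c \<notin> higson_eval ` M"
  proof
    assume "corona_point c \<in> higson_eval ` M"
    then obtain x where x: "x \<in> M" "corona_point c = higson_eval x"
      by blast
    define \<phi> where "\<phi> = (\<lambda>y\<in>M. complex_of_real (max 0 (1 - d x y)))"
    have \<phi>: "\<phi> \<in> higson_functions"
      unfolding \<phi>_def using x(1) by (rule higson_function_bump)
    have "higson_lim F \<phi> = \<phi> x"
      using lim[OF \<phi>] x \<phi> by (simp add: higson_eval_def)
    then have "higson_lim F \<phi> = 1"
      using x(1) by (simp add: \<phi>_def)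
    then have "{y \<in> M. dist (\<phi> y) 1 < 1} \<in> F"
      using higson_lim[OF F(1) \<phi>, of 1] by simp
    \<comment> \<open>A value at distance less than 1 from 1 is nonzero, which happens only inside
      the unit ball.\<close>
    moreover have "{y \<in> M. dist (\<phi> y) 1 < 1} \<subseteq> mcball x 1"
      using x(1) by (auto simp: \<phi>_def max_def split: if_splits)
    ultimately show False
      using coarse_ultrafilter_not_mbounded[OF F(1)] mbounded_subset mbounded_mcball by blast
  qed
qed

section \<open>Surjectivity of the limit map\<close>

lemma corona_point_surj:
  assumes proper: proper_metric and p: "p \<in> topspace higson_corona"
  shows "p \<in> corona_point ` corona"
proof -
  define F where "F = {A. A \<subseteq> M \<and> p \<in> higson_product closure_of (higson_eval ` A)}"
  have F: "coarse_ultrafilter F"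
    unfolding coarse_ultrafilter_def
  proof (intro conjI ballI allI impI)
    show "F \<subseteq> Pow M"
      by (auto simp: F_def)
    show "M \<in> F"
      using p by (simp add: F_def topspace_higson_corona)
    \<comment> \<open>Closure commutes with finite unions.\<close>
    fix A B assume "A \<subseteq> M \<and> B \<subseteq> M \<and> A \<union> B \<in> F"
    then show "A \<in> F \<or> B \<in> F"
      by (auto simp: F_def image_Un)
  next
    fix A B assume "A \<in> F" "B \<in> F"
    then have AB: "A \<subseteq> M" "B \<subseteq> M" and A: "p \<in> higson_product closure_of (higson_eval ` A)"
      and B: "p \<in> higson_product closure_of (higson_eval ` B)"
      by (auto simp: F_def)
    show "close A B"
    proof
      \<comment> \<open>A separating function would force \<open>p \<phi>\<close> to be 0 and to
        have norm at least \<open>1 / 2\<close>; the second claim requires discarding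
        \<open>K\<close>, which properness permits.\<close>
      assume "coarsely_disjoint A B"
      then obtain \<phi> K where \<phi>: "\<phi> \<in> higson_functions" "mbounded K"
          "\<And>x. x \<in> A \<Longrightarrow> \<phi> x = 0" "\<And>x. x \<in> B - K \<Longrightarrow> norm (\<phi> x) \<ge> 1 / 2"
        using higson_function_separating AB by metis
      have "p \<phi> \<in> closure (\<phi> ` A)"
        using A \<phi>(1) by (rule closure_of_higson_eval_component)
      also have "\<dots> \<subseteq> {0}"
        using \<phi>(3) by (intro closure_minimal) auto
      finally have "p \<phi> = 0"
        by simp
      have "p \<phi> \<in> closure (\<phi> ` (B - K))"
        using proper_metric_closure_of_higson_eval[OF proper p \<phi>(2) AB(2) B] \<phi>(1)
        by (rule closure_of_higson_eval_component)
      also have "\<dots> \<subseteq> {z. norm z \<ge> 1 / 2}"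
        using \<phi>(4) by (intro closure_minimal closed_Collect_le continuous_intros) auto
      finally show False
        using \<open>p \<phi> = 0\<close> by simp
    qed
  qed
  have lim: "higson_lim F \<phi> = p \<phi>" if \<phi>: "\<phi> \<in> higson_functions" for \<phi>
  proof -
    have "dist (p \<phi>) (higson_lim F \<phi>) \<le> e" if "e > 0" for e
    proof -
      \<comment> \<open>Membership of \<open>A\<close> in \<open>F\<close> means that
        \<open>p\<close> adheres to its image, so the coordinate \<open>p \<phi>\<close> is within
        \<open>e\<close> of the limit.\<close>
      define A where "A = {x \<in> M. dist (\<phi> x) (higson_lim F \<phi>) < e}"
      have "A \<in> F"
        unfolding A_def using F \<phi> that by (rule higson_lim)
      then have "p \<phi> \<in> closure (\<phi> ` A)"
        using \<phi> by (intro closure_of_higson_eval_component) (simp_all add: F_def)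
      also have "\<dots> \<subseteq> cball (higson_lim F \<phi>) e"
        by (intro closure_minimal) (auto simp: A_def dist_commute)
      finally show ?thesis
        by (simp add: dist_commute)
    qed
    then have "dist (p \<phi>) (higson_lim F \<phi>) \<le> 0"
      using field_le_epsilon[of "dist (p \<phi>) (higson_lim F \<phi>)" 0] by simp
    then show ?thesis
      by simp
  qed
  define c where "c = asymptotically_alike `` {F}"
  have c: "c \<in> corona" "F \<in> c"
    using F asymptotically_alike_refl by (auto simp: c_def corona_def quotient_def)
  have "p \<in> extensional higson_functions"
    using p unfolding higson_corona_eq by (auto simp: PiE_def)
  moreover have "corona_point c \<in> extensional higson_functions"
    by (simp add: corona_point_def)
  ultimately have "corona_point c = p"
    using corona_point[OF c] lim by (intro extensionalityI) auto
  then show ?thesis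
    using c by blast
qed

section \<open>Continuity and openness of the limit map\<close>

lemma continuous_map_corona_point: "continuous_map corona_topology higson_corona corona_point"
proof -
  have "continuous_map corona_topology euclidean (\<lambda>c. corona_point c \<phi>)"
    if \<phi>: "\<phi> \<in> higson_functions" for \<phi>
    unfolding continuous_map
  proof (intro conjI allI impI)
    fix V :: "complex set" assume "openin euclidean V"
    then have "open V" by simp
    define W where "W = {c \<in> corona. corona_point c \<phi> \<in> V}"
    have "corona_far {c} (corona - W)" if "c \<in> W" for c
    proof -
      have c: "c \<in> corona" "corona_point c \<phi> \<in> V"
        using that by (auto simp: W_def)
      define z where "z = corona_point c \<phi>"
      obtain e where e: "e > 0" "ball z e \<subseteq> V"
        using \<open>open V\<close> c(2) unfolding z_def by (meson open_contains_ball)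
      \<comment> \<open>The gap \<open>e / 2 - e / 3 = e / 6\<close> makes \<open>A\<close> and
        \<open>B\<close> coarsely disjoint, and \<open>e / 2 < e\<close> keeps the closed ball of
        radius \<open>e / 2\<close> inside \<open>V\<close>.\<close>
      define A B where "A = {x \<in> M. dist (\<phi> x) z < e / 3}"
        and "B = {x \<in> M. dist (\<phi> x) z > e / 2}"
      have "coarsely_disjoint A B"
      proof (rule higson_function_coarsely_disjoint[OF \<phi>, of _ _ "e / 6"])
        fix a b assume "a \<in> A" "b \<in> B"
        then show "e / 6 \<le> dist (\<phi> a) (\<phi> b)"
          using dist_triangle2[of "\<phi> b" z "\<phi> a"] by (simp add: A_def B_def dist_commute)
      qed (use e in \<open>auto simp: A_def B_def\<close>)
      moreover have "c \<in> corona_cl A"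
      proof -
        obtain F where F: "coarse_ultrafilter F" "F \<in> c"
          using c corona_cases by metis
        then have "A \<in> F"
          using higson_lim[OF F(1) \<phi>, of "e / 3"] corona_point[OF c(1) F(2) \<phi>] e(1)
          by (simp add: A_def z_def)
        then show ?thesis
          using c(1) F(2) by (auto simp: corona_cl_def)
      qed
      moreover have "corona - W \<subseteq> corona_cl B"
      proof
        fix b assume b: "b \<in> corona - W"
        then obtain F where F: "coarse_ultrafilter F" "F \<in> b"
          using corona_cases by (metis DiffD1)
        \<comment> \<open>Otherwise the limit along \<open>F\<close> would lie in that closed ball,
          hence in \<open>V\<close>, and \<open>b\<close> in \<open>W\<close>.\<close>
        have "M - B \<notin> F"
        proof
          assume "M - B \<in> F"
          then have "higson_lim F \<phi> \<in> closure (\<phi> ` (M - B))"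
            using F(1) \<phi> higson_lim_in_closure by blast
          also have "\<dots> \<subseteq> cball z (e / 2)"
            by (intro closure_minimal) (auto simp: B_def dist_commute)
          also have "\<dots> \<subseteq> V"
            using e by force
          finally show False
            using b corona_point[of b F \<phi>] F(2) \<phi> by (simp add: W_def)
        qed
        moreover have "B \<union> (M - B) \<in> F"
        proof -
          have "B \<union> (M - B) = M"
            by (auto simp: B_def)
          then show ?thesis
            using F(1) by (simp add: coarse_ultrafilter_def)
        qed
        ultimately have "B \<in> F"
          using coarse_ultrafilter_Un[OF F(1)] by blast
        then show "b \<in> corona_cl B"
          using b F(2) by (auto simp: corona_cl_def)
      qed
      moreover have "A \<subseteq> M" "B \<subseteq> M"
        by (auto simp: A_def B_def)
      ultimately show ?thesis
        unfolding corona_far_def by blast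
    qed
    then have "corona_open W"
      by (auto simp: corona_open_alt W_def)
    then show "openin corona_topology {c \<in> topspace corona_topology. corona_point c \<phi> \<in> V}"
      by (simp add: openin_corona_topology W_def)
  qed simp
  then have "continuous_map corona_topology higson_product corona_point"
    unfolding continuous_map_componentwise by (auto simp: corona_point_def)
  moreover have "corona_point \<in> corona \<rightarrow>
      higson_product closure_of (higson_eval ` M) - higson_eval ` M"
    using corona_point_in_higson_corona by (auto simp: topspace_higson_corona)
  ultimately show ?thesis
    unfolding higson_corona_eq by (simp add: continuous_map_in_subtopology)
qed

text \<open>Let \<phi> separate the witnesses \<open>A\<close> and \<open>B\<close> of farness. The
  open condition that the \<phi>-coordinate has norm below \<open>1 / 2\<close> holds at the image
  of \<open>c\<close> and fails at every class in \<open>corona_cl B\<close>, thus at every class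
  outside \<open>U\<close>. Surjectivity ensures that all points meeting it come from
  classes.\<close>

lemma open_map_corona_point:
  assumes proper_metric
  shows "open_map corona_topology higson_corona corona_point"
  unfolding open_map_def
proof (intro allI impI)
  fix U assume "openin corona_topology U"
  then have U: "U \<subseteq> corona" "\<And>c. c \<in> U \<Longrightarrow> corona_far {c} (corona - U)"
    by (auto simp: openin_corona_topology corona_open_alt)
  show "openin higson_corona (corona_point ` U)"
  proof (rule openin_subopen[THEN iffD2], clarify)
    fix c assume "c \<in> U"
    then have "corona_far {c} (corona - U)"
      by (rule U(2))
    then obtain A B where AB: "A \<subseteq> M" "B \<subseteq> M" "coarsely_disjoint A B"
        "c \<in> corona_cl A" "corona - U \<subseteq> corona_cl B"
      unfolding corona_far_def by blast
    obtain \<phi> K where \<phi>: "\<phi> \<in> higson_functions" "mbounded K"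
        "\<And>x. x \<in> A \<Longrightarrow> \<phi> x = 0" "\<And>x. x \<in> B - K \<Longrightarrow> norm (\<phi> x) \<ge> 1 / 2"
      using higson_function_separating AB by metis
    define T where "T = {p \<in> topspace higson_corona. p \<phi> \<in> ball 0 (1 / 2)}"
    have "continuous_map higson_corona euclidean (\<lambda>p. p \<phi>)"
      unfolding higson_corona_eq using \<phi>(1)
      by (intro continuous_map_from_subtopology continuous_map_product_projection)
    then have "openin higson_corona T"
      unfolding T_def by (rule openin_continuous_map_preimage) simp
    moreover have "corona_point c \<in> T"
    proof -
      obtain F where F: "c \<in> corona" "F \<in> c" "A \<in> F"
        using AB(4) by (auto simp: corona_cl_def)
      then have "corona_point c \<phi> = 0"
        using corona_point[OF F(1,2) \<phi>(1)] higson_lim_separating(1)[OF _ \<phi>(1) _ \<phi>(2)]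
          mem_coronaD \<phi>(3) by metis
      then show ?thesis
        using F(1) by (simp add: T_def corona_point_in_higson_corona)
    qed
    moreover have "T \<subseteq> corona_point ` U"
    proof
      fix p assume p: "p \<in> T"
      then obtain b where b: "b \<in> corona" "p = corona_point b"
        using corona_point_surj[OF assms] by (auto simp: T_def)
      have "b \<in> U"
      proof (rule ccontr)
        assume "b \<notin> U"
        then obtain F where F: "F \<in> b" "B \<in> F"
          using AB(5) b(1) by (auto simp: corona_cl_def)
        have "norm (p \<phi>) \<ge> 1 / 2"
          unfolding b(2) corona_point[OF b(1) F(1) \<phi>(1)]
          using mem_coronaD[OF b(1) F(1)] \<phi>(1) F(2) \<phi>(2,4) by (rule higson_lim_separating(2))
        then show False
          using p by (simp add: T_def)
      qed
      then show "p \<in> corona_point ` U"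
        using b(2) by blast
    qed
    ultimately show "\<exists>T. openin higson_corona T \<and> corona_point c \<in> T \<and> T \<subseteq> corona_point ` U"
      by blast
  qed
qed

lemma homeomorphic_map_corona_point:
  assumes proper_metric
  shows "homeomorphic_map corona_topology higson_corona corona_point"
proof (rule bijective_open_imp_homeomorphic_map)
  show "corona_point ` topspace corona_topology = topspace higson_corona"
    using corona_point_in_higson_corona corona_point_surj[OF assms] by auto
qed (use assms in \<open>simp_all add: continuous_map_corona_point open_map_corona_point inj_on_corona_point\<close>)

end

theorem proposition27:
  fixes M :: "'a set" and d :: "'a \<Rightarrow> 'a \<Rightarrow> real"
  assumes "Metric_space M d"
    and "Metric_space.proper_metric M d"
  shows "Metric_space.corona_topology M d homeomorphic_space Metric_space.higson_corona M d"
  using Metric_space.homeomorphic_map_corona_point[OF assms]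
  by (rule homeomorphic_map_imp_homeomorphic_space)

end
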